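(* Let $T$ be a local domain with maximal ideal $\mathfrak{m}$, let $\kappa := T/\mathfrak{m}$, and let $B$ be an integral domain having quotient field $\kappa$. Let $\phi: T\to\kappa$ be the canonical surjective map and define the ring $D := \phi^{-1}(B)$. Then $D$ is a Bezout Intersection domain (respectively, a Strong Bezout Intersection domain) if and only if $B$ is a Bezout Intersection domain (respectively, a Strong Bezout Intersection domain).
   Context: "Local" means having a unique maximal ideal (not necessarily Noetherian). The ring $D$ is the pullback of the inclusion $B\hookrightarrow\kappa$ along $\phi: T\to\kappa$. Elements $a_1,\dots,a_n$ (with $n\ge 2$) of an integral domain $A$ are pairwise incomparable if $a_i\notin (a_j)$ for all $i\neq j$. An integral domain $A$ is a Bezout Intersection domain (BID) if for any finite collection of pairwise incomparable elements $a_1,\dots,a_n\in A$ the ideal $(a_1)\cap\dots\cap(a_n)$ is either principal or not finitely generated. $A$ is a Strong Bezout Intersection domain (SBID) if for any finite collection of pairwise incomparable elements $a_1,\dots,a_n\in A$ with $n\ge 2$, the ideal $(a_1)\cap\dots\cap(a_n)$ is not finitely generated.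
   Formalization: The formal theorem assumes B is a proper subring of κ unless T is a field; without this the claim fails, e.g. T = k[[x²,x³]], B = κ = k: the field B is vacuously BID and SBID, while D = T is neither, since (x²)∩(x³) = (x⁵,x⁶) is finitely generated and not principal. *)

theory Defs
  imports "HOL-Algebra.Algebra"
begin

text \<open>The maximal ideal is an argument of the predicate; no Noetherian hypothesis.\<close>

definition local_domain :: "('a, 'b) ring_scheme \<Rightarrow> 'a set \<Rightarrow> bool" where
  "local_domain T m \<longleftrightarrow>
     domain T \<and> maximalideal m T \<and> (\<forall>J. maximalideal J T \<longrightarrow> J = m)"

text \<open>\<open>B\<close> is identified with its image in its quotient field \<open>K\<close>, i.e. it is a
  subring of \<open>K\<close> and every element of \<open>K\<close> is a fraction of elements of \<open>B\<close>.\<close>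

definition has_quotient_field :: "'a set \<Rightarrow> ('a, 'b) ring_scheme \<Rightarrow> bool" where
  "has_quotient_field B K \<longleftrightarrow>
     field K \<and> subdomain B K \<and>
     (\<forall>x \<in> carrier K. \<exists>a \<in> B. \<exists>b \<in> B - {\<zero>\<^bsub>K\<^esub>}. x = a \<otimes>\<^bsub>K\<^esub> inv\<^bsub>K\<^esub> b)"

text \<open>The canonical map \<open>T \<rightarrow> T / m\<close> sends \<open>x\<close> to the coset \<open>m + x\<close>, so this is the preimage
  of \<open>B \<subseteq> T / m\<close>, as a subring of \<open>T\<close>.\<close>

definition pullback_ring ::
    "('a, 'b) ring_scheme \<Rightarrow> 'a set \<Rightarrow> 'a set set \<Rightarrow> ('a, 'b) ring_scheme" where
  "pullback_ring T m B = T\<lparr>carrier := {x \<in> carrier T. m +>\<^bsub>T\<^esub> x \<in> B}\<rparr>"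

definition fin_gen_ideal :: "'a set \<Rightarrow> ('a, 'b) ring_scheme \<Rightarrow> bool" where
  "fin_gen_ideal I A \<longleftrightarrow>
     (\<exists>S. finite S \<and> S \<subseteq> carrier A \<and> I = Idl\<^bsub>A\<^esub> S)"

text \<open>The families are indexed by \<open>{1..n}\<close>; values of \<open>a\<close> outside it are irrelevant. The
  requirement \<open>2 \<le> n\<close> is part of the notion; families with \<open>n < 2\<close> must not count,
  as their intersections of principal ideals are always principal.\<close>

definition pairwise_incomparable ::
    "('a, 'b) ring_scheme \<Rightarrow> nat \<Rightarrow> (nat \<Rightarrow> 'a) \<Rightarrow> bool" where
  "pairwise_incomparable A n a \<longleftrightarrow>
     2 \<le> n \<and> (\<forall>i \<in> {1..n}. a i \<in> carrier A) \<and>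
     (\<forall>i \<in> {1..n}. \<forall>j \<in> {1..n}. i \<noteq> j \<longrightarrow> a i \<notin> PIdl\<^bsub>A\<^esub> (a j))"

definition BID :: "('a, 'b) ring_scheme \<Rightarrow> bool" where
  "BID A \<longleftrightarrow> domain A \<and>
     (\<forall>n a. pairwise_incomparable A n a \<longrightarrow>
        principalideal (\<Inter>i \<in> {1..n}. PIdl\<^bsub>A\<^esub> (a i)) A \<or>
        \<not> fin_gen_ideal (\<Inter>i \<in> {1..n}. PIdl\<^bsub>A\<^esub> (a i)) A)"

definition SBID :: "('a, 'b) ring_scheme \<Rightarrow> bool" where
  "SBID A \<longleftrightarrow> domain A \<and>
     (\<forall>n a. pairwise_incomparable A n a \<longrightarrow>
        \<not> fin_gen_ideal (\<Inter>i \<in> {1..n}. PIdl\<^bsub>A\<^esub> (a i)) A)"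

end

theory Submission
  imports Defs
begin

text \<open>
  An element of \<open>T\<close> outside \<open>m\<close> is a unit of \<open>T\<close>, so every \<open>a \<in> D - m\<close> divides each element \<open>y\<close>
  of \<open>m\<close> inside \<open>D\<close>: the cofactor \<open>y / a\<close> lies in \<open>m \<subseteq> D\<close>. Hence passing to the quotient
  \<open>D / m = B\<close> changes nothing for families outside \<open>m\<close>: incomparability, the intersection of the
  principal ideals, finite generation and principality all correspond (locale
  \<open>divided_kernel\<close>). Lifting an incomparable family from \<open>B\<close> therefore gives the direction from \<open>D\<close>
  to \<open>B\<close>.

  For the converse, let \<open>a\<^sub>1, \<dots>, a\<^sub>n\<close> be incomparable in \<open>D\<close>, with intersection \<open>I\<close>.
  If the \<open>a\<^sub>i\<close> are associates of each other in \<open>T\<close>, then, because \<open>\<kappa>\<close> is the fraction field of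
  \<open>B\<close>, the ratios have a common denominator, and \<open>a\<^sub>i = s v\<^sub>i\<close> for one \<open>s \<in> T\<close> and some
  \<open>v\<^sub>i \<in> D - m\<close>. Multiplication by \<open>s\<close> identifies \<open>I\<close> with the intersection for the \<open>v\<^sub>i\<close>, and
  the first paragraph applies (\<open>associated_family_descends\<close>).

  If they are not all associates, then \<open>I\<close> is not finitely generated
  (\<open>nonassociated_family_not_fin_gen\<close>). Indeed, suppose some \<open>x = a\<^sub>i d \<in> I\<close> had \<open>d \<notin> m\<close>. Then every
  \<open>a\<^sub>j\<close> would divide \<open>a\<^sub>i\<close> in \<open>T\<close>, with a cofactor that is a unit, as a cofactor in \<open>m \<subseteq> D\<close> would
  contradict incomparability. So all cofactors of elements of \<open>I\<close> lie in the \<open>T\<close>-ideal \<open>m\<close>, and \<open>I\<close>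
  is closed under multiplication by \<open>T\<close>. A nonzero nonunit among the \<open>a\<^sub>i\<close> shows \<open>m \<noteq> 0\<close>, and then
  \<open>B \<noteq> \<kappa>\<close> by hypothesis, that is, \<open>B\<close> is not a field. Thus \<open>D - m\<close> contains a nonunit \<open>c\<close> of \<open>D\<close>;
  it is a unit of \<open>T\<close>, whence \<open>c I = I\<close>. By Nakayama's argument no nonzero finitely
  generated ideal \<open>I\<close> of a domain satisfies \<open>I = c I\<close> with a nonunit \<open>c\<close> (\<open>divisor_of_fin_gen_ideal_is_unit\<close>).
\<close>

section \<open>Ideals in commutative rings and domains\<close>

text \<open>Zorn's lemma for the ideals that contain \<open>a\<close> but not \<open>\<one>\<close>; it is what turns uniqueness of the
  maximal ideal into invertibility of all elements outside it.\<close>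

lemma (in cring) nonunit_in_maximalideal:
  assumes a: "a \<in> carrier R" "a \<notin> Units R"
  obtains M where "maximalideal M R" "a \<in> M"
proof -
  let ?F = "{I. ideal I R \<and> a \<in> I \<and> \<one> \<notin> I}"
  have "\<exists>M\<in>?F. \<forall>J\<in>?F. M \<subseteq> J \<longrightarrow> J = M"
  proof (rule subset_Zorn_nonempty)
    have "\<one> \<notin> PIdl a"
      using a m_comm unfolding cgenideal_def Units_def by fastforce
    then show "?F \<noteq> {}"
      using cgenideal_ideal[OF a(1)] cgenideal_self[OF a(1)] by blast
  next
    fix C assume C: "C \<noteq> {}" "subset.chain ?F C"
    then have "subset.chain {I. ideal I R} C"
      unfolding pred_on.chain_def by blast
    then have "ideal (\<Union>C) R"
      using chain_Union_is_ideal[of C] C(1) by simp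
    then show "\<Union>C \<in> ?F"
      using C unfolding pred_on.chain_def by blast
  qed
  then obtain M where M: "ideal M R" "a \<in> M" "\<one> \<notin> M"
    and max: "\<And>J. ideal J R \<Longrightarrow> a \<in> J \<Longrightarrow> \<one> \<notin> J \<Longrightarrow> M \<subseteq> J \<Longrightarrow> J = M"
    by blast
  have "maximalideal M R"
  proof (rule maximalidealI[OF M(1)])
    show "carrier R \<noteq> M" using M(3) by auto
    show "J = M \<or> J = carrier R" if "ideal J R" "M \<subseteq> J" "J \<subseteq> carrier R" for J
      using that max M(2) ideal.one_imp_carrier by blast
  qed
  then show thesis using that M(2) by blast
qed

lemma (in ring_hom_ring) ideal_image:
  assumes surj: "h ` carrier R = carrier S" and I: "ideal I R"
  shows "ideal (h ` I) S"
proof (rule idealI[OF S.ring_axioms])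
  show "subgroup (h ` I) (add_monoid S)"
    using img_is_add_subgroup additive_subgroup.a_subgroup ideal.axioms(1) I by blast
next
  fix a x assume "a \<in> h ` I" "x \<in> carrier S"
  then obtain i r where ir: "i \<in> I" "a = h i" "r \<in> carrier R" "x = h r"
    using surj by blast
  have i: "i \<in> carrier R" using ideal.Icarr[OF I ir(1)] .
  have "x \<otimes>\<^bsub>S\<^esub> a = h (r \<otimes> i)" "a \<otimes>\<^bsub>S\<^esub> x = h (i \<otimes> r)" using ir i by simp_all
  then show "x \<otimes>\<^bsub>S\<^esub> a \<in> h ` I" "a \<otimes>\<^bsub>S\<^esub> x \<in> h ` I"
    using ideal.I_l_closed[OF I ir(1,3)] ideal.I_r_closed[OF I ir(1,3)] by auto
qed

text \<open>The conclusion says that \<open>M / N\<close> is killed by an element congruent to \<open>\<one>\<close> modulo \<open>c\<close>.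
  Working relative to \<open>N\<close> replaces the determinant trick by an induction on the generators: one
  generator \<open>x\<close> at a time is absorbed into \<open>N\<close>, and two annihilators congruent to \<open>\<one>\<close> are
  multiplied.\<close>

lemma (in cring) relative_Nakayama:
  assumes "finite S" "ideal N R" "ideal M R" "S \<subseteq> M" "N \<subseteq> M" "M \<subseteq> Idl (N \<union> S)"
    and c: "c \<in> carrier R"
    and "\<And>y. y \<in> M \<Longrightarrow> \<exists>n\<in>N. \<exists>z\<in>M. y = n \<oplus> c \<otimes> z"
  shows "\<exists>d\<in>carrier R. \<forall>y\<in>M. (\<one> \<ominus> c \<otimes> d) \<otimes> y \<in> N"
  using assms(1,2,4-6,8)
proof (induction S arbitrary: N rule: finite_induct)
  case empty
  have "M \<subseteq> N"
    using empty genideal_minimal[OF empty(1), of N] by auto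
  moreover have "(\<one> \<ominus> c \<otimes> \<zero>) \<otimes> y = y" if "y \<in> M" for y
    using ideal.Icarr[OF assms(3) that] c by algebra
  ultimately show ?case by (intro bexI[of _ \<zero>]) auto
next
  case (insert x S)
  interpret N: ideal N R by fact
  interpret M: ideal M R by fact
  have xM: "x \<in> M" and x: "x \<in> carrier R" using insert.prems(2) M.Icarr by auto
  let ?N' = "N <+>\<^bsub>R\<^esub> PIdl x"
  have PM: "PIdl x \<subseteq> M" by (rule cgenideal_minimal[OF assms(3) xM])
  have idN': "ideal ?N' R" by (rule add_ideals[OF insert.prems(1) cgenideal_ideal[OF x]])
  have memN': "y \<in> ?N' \<longleftrightarrow> (\<exists>n\<in>N. \<exists>r\<in>carrier R. y = n \<oplus> r \<otimes> x)" for y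
    unfolding set_add_def' cgenideal_def by blast
  have NN': "N \<subseteq> ?N'"
  proof
    fix n assume n: "n \<in> N"
    then have "n = n \<oplus> \<zero> \<otimes> x" using x N.Icarr by simp
    then show "n \<in> ?N'" using memN' n by blast
  qed
  have xN': "x \<in> ?N'"
  proof -
    have "x = \<zero> \<oplus> \<one> \<otimes> x" using x by simp
    then show ?thesis using memN' N.zero_closed by blast
  qed
  have N'M: "?N' \<subseteq> M"
    using insert.prems(3) PM unfolding set_add_def' by (auto intro: M.a_closed)
  have "Idl (N \<union> insert x S) \<subseteq> Idl (?N' \<union> S)"
  proof (rule genideal_minimal[OF genideal_ideal])
    show "?N' \<union> S \<subseteq> carrier R" using N'M insert.prems(2) M.Icarr by blast
    then show "N \<union> insert x S \<subseteq> Idl (?N' \<union> S)"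
      using genideal_self[of "?N' \<union> S"] NN' xN' by blast
  qed
  then have gen: "M \<subseteq> Idl (?N' \<union> S)" using insert.prems(4) by (rule order_trans[rotated])
  have SM: "S \<subseteq> M" using insert.prems(2) by simp
  have div: "\<exists>n\<in>?N'. \<exists>z\<in>M. y = n \<oplus> c \<otimes> z" if "y \<in> M" for y
    using insert.prems(5)[OF that] NN' by blast
  obtain d where d: "d \<in> carrier R" and dM: "\<And>y. y \<in> M \<Longrightarrow> (\<one> \<ominus> c \<otimes> d) \<otimes> y \<in> ?N'"
    using insert.IH[OF idN' SM N'M gen div] by auto
  \<comment> \<open>Writing \<open>x = n \<oplus> c \<otimes> z\<close> and pushing \<open>z\<close> into \<open>N + R x\<close> yields a multiplier congruent to \<open>\<one>\<close> that sends \<open>x\<close> into \<open>N\<close>.\<close>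
  obtain n z where nz: "n \<in> N" "z \<in> M" "x = n \<oplus> c \<otimes> z" using insert.prems(5)[OF xM] by blast
  obtain n' e where ne: "n' \<in> N" "e \<in> carrier R" "(\<one> \<ominus> c \<otimes> d) \<otimes> z = n' \<oplus> e \<otimes> x"
    using dM[OF nz(2)] memN' by blast
  note carr = N.Icarr[OF nz(1)] M.Icarr[OF nz(2)] N.Icarr[OF ne(1)] ne(2) d c x
  have "(\<one> \<ominus> c \<otimes> d) \<otimes> x = (\<one> \<ominus> c \<otimes> d) \<otimes> n \<oplus> c \<otimes> ((\<one> \<ominus> c \<otimes> d) \<otimes> z)"
    using carr by (subst nz(3)) algebra
  then have "(\<one> \<ominus> c \<otimes> d) \<otimes> x = (\<one> \<ominus> c \<otimes> d) \<otimes> n \<oplus> c \<otimes> (n' \<oplus> e \<otimes> x)"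
    using ne(3) by simp
  moreover have "(\<one> \<ominus> c \<otimes> d \<ominus> c \<otimes> e) \<otimes> x = (\<one> \<ominus> c \<otimes> d) \<otimes> x \<ominus> c \<otimes> (e \<otimes> x)"
    using carr by algebra
  ultimately have "(\<one> \<ominus> c \<otimes> d \<ominus> c \<otimes> e) \<otimes> x
      = (\<one> \<ominus> c \<otimes> d) \<otimes> n \<oplus> c \<otimes> (n' \<oplus> e \<otimes> x) \<ominus> c \<otimes> (e \<otimes> x)"
    by simp
  also have "\<dots> = (\<one> \<ominus> c \<otimes> d) \<otimes> n \<oplus> c \<otimes> n'"
    using carr by algebra
  finally have eq: "(\<one> \<ominus> c \<otimes> d \<ominus> c \<otimes> e) \<otimes> x = (\<one> \<ominus> c \<otimes> d) \<otimes> n \<oplus> c \<otimes> n'" .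
  have killx: "(\<one> \<ominus> c \<otimes> d \<ominus> c \<otimes> e) \<otimes> x \<in> N"
    unfolding eq using carr nz(1) ne(1) by (simp add: N.I_l_closed N.a_closed)
  \<comment> \<open>\<open>\<one> \<ominus> c \<otimes> ?f\<close> is the product of the multipliers \<open>\<one> \<ominus> c \<otimes> d\<close> and \<open>\<one> \<ominus> c \<otimes> (d \<oplus> e)\<close>.\<close>
  let ?f = "d \<oplus> (\<one> \<ominus> c \<otimes> d) \<otimes> (d \<oplus> e)"
  have "(\<one> \<ominus> c \<otimes> ?f) \<otimes> y \<in> N" if y: "y \<in> M" for y
  proof -
    obtain n'' r where nr: "n'' \<in> N" "r \<in> carrier R" "(\<one> \<ominus> c \<otimes> d) \<otimes> y = n'' \<oplus> r \<otimes> x"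
      using dM[OF y] memN' by blast
    note yc = M.Icarr[OF y] N.Icarr[OF nr(1)]
    have "(\<one> \<ominus> c \<otimes> ?f) \<otimes> y = (\<one> \<ominus> c \<otimes> d \<ominus> c \<otimes> e) \<otimes> ((\<one> \<ominus> c \<otimes> d) \<otimes> y)"
      using carr yc by algebra
    also have "\<dots> = (\<one> \<ominus> c \<otimes> d \<ominus> c \<otimes> e) \<otimes> n'' \<oplus> r \<otimes> ((\<one> \<ominus> c \<otimes> d \<ominus> c \<otimes> e) \<otimes> x)"
      unfolding nr(3) using carr yc nr(2) by algebra
    also have "\<dots> \<in> N"
      using killx carr nr by (simp add: N.I_l_closed N.a_closed)
    finally show ?thesis .
  qed
  moreover have "?f \<in> carrier R" using carr by simp
  ultimately show ?case by blast
qed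

text \<open>Nakayama's argument with \<open>N = {\<zero>}\<close>: some \<open>\<one> \<ominus> c \<otimes> d\<close> annihilates \<open>I\<close>, which in a domain forces
  \<open>c \<otimes> d = \<one>\<close>.\<close>

lemma (in domain) divisor_of_fin_gen_ideal_is_unit:
  assumes "fin_gen_ideal I R" and y: "y \<in> I" "y \<noteq> \<zero>" and c: "c \<in> carrier R"
    and div: "\<And>y. y \<in> I \<Longrightarrow> \<exists>z\<in>I. y = c \<otimes> z"
  shows "c \<in> Units R"
proof -
  obtain S where S: "finite S" "S \<subseteq> carrier R" "I = Idl S"
    using assms(1) unfolding fin_gen_ideal_def by blast
  have I: "ideal I R" unfolding S(3) by (rule genideal_ideal[OF S(2)])
  interpret I: ideal I R by fact
  have SI: "S \<subseteq> I" unfolding S(3) by (rule genideal_self[OF S(2)])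
  have "Idl S \<subseteq> Idl ({\<zero>} \<union> S)"
    by (rule subset_Idl_subset) (use S in auto)
  then obtain d where d: "d \<in> carrier R" "\<forall>y\<in>I. (\<one> \<ominus> c \<otimes> d) \<otimes> y \<in> {\<zero>}"
    using relative_Nakayama[OF S(1) zeroideal I SI, of c] S(3) c div I.Icarr by fastforce
  then have "(\<one> \<ominus> c \<otimes> d) \<otimes> y = \<zero>" using y(1) by blast
  then have "\<one> \<ominus> c \<otimes> d = \<zero>"
    using integral[of "\<one> \<ominus> c \<otimes> d" y] y I.Icarr[OF y(1)] c d(1) by auto
  moreover have "c \<otimes> d = \<one> \<ominus> (\<one> \<ominus> c \<otimes> d)" using c d(1) by algebra
  ultimately have "c \<otimes> d = \<one> \<ominus> \<zero>" by (rule subst)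
  then have "c \<otimes> d = \<one>" by (simp add: minus_eq)
  moreover from this have "d \<otimes> c = \<one>" using m_comm[OF d(1) c] by simp
  ultimately show ?thesis using c d(1) unfolding Units_def by blast
qed

text \<open>The product of the \<open>a i\<close> is such an element.\<close>

lemma (in domain) Inter_PIdl_nonzero:
  assumes "finite I" "\<And>i. i \<in> I \<Longrightarrow> a i \<in> carrier R - {\<zero>}"
  shows "\<exists>x\<in>carrier R. x \<noteq> \<zero> \<and> (\<forall>i\<in>I. x \<in> PIdl (a i))"
  using assms
proof (induction I rule: finite_induct)
  case empty
  show ?case using one_closed one_not_zero by blast
next
  case (insert j I)
  then obtain x where x: "x \<in> carrier R" "x \<noteq> \<zero>" "\<And>i. i \<in> I \<Longrightarrow> x \<in> PIdl (a i)" by auto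
  have j: "a j \<in> carrier R" "a j \<noteq> \<zero>" using insert.prems by auto
  have "a j \<otimes> x \<in> PIdl (a i)" if "i \<in> I" for i
    using ideal.I_l_closed[OF cgenideal_ideal x(3)] insert.prems that j by auto
  moreover have "a j \<otimes> x \<in> PIdl (a j)"
    unfolding cgenideal_def using x j m_comm by blast
  moreover have "a j \<otimes> x \<noteq> \<zero>" using integral x j by blast
  ultimately show ?case using x j by (intro bexI[of _ "a j \<otimes> x"]) auto
qed

lemma (in cring) Inter_PIdl_ideal:
  assumes "I \<noteq> {}" "\<And>i. i \<in> I \<Longrightarrow> a i \<in> carrier R"
  shows "ideal (\<Inter>i\<in>I. PIdl (a i)) R"
  by (rule i_Intersect) (use assms cgenideal_ideal in auto)

lemma (in cring) principalideal_iff: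
  "principalideal I R \<longleftrightarrow> (\<exists>x\<in>carrier R. I = Idl {x})"
proof
  show "principalideal I R \<Longrightarrow> \<exists>x\<in>carrier R. I = Idl {x}" by (rule principalideal.generate)
  show "\<exists>x\<in>carrier R. I = Idl {x} \<Longrightarrow> principalideal I R"
    using cgenideal_is_principalideal cgenideal_eq_genideal by metis
qed

text \<open>Zero lies in every principal ideal, and \<open>n \<ge> 2\<close> provides another member to compare with.\<close>

lemma (in cring) incomparable_nonzero:
  assumes "pairwise_incomparable R n a" "i \<in> {1..n}"
  shows "a i \<in> carrier R" "a i \<noteq> \<zero>"
proof -
  show "a i \<in> carrier R" using assms unfolding pairwise_incomparable_def by auto
  have n: "2 \<le> n" using assms(1) unfolding pairwise_incomparable_def by blast
  obtain j where j: "j \<in> {1..n}" "j \<noteq> i"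
  proof (cases "i = 1")
    case True then show thesis using that[of 2] n by simp
  next
    case False then show thesis using that[of 1] n by simp
  qed
  have "a i \<notin> PIdl (a j)" "a j \<in> carrier R"
    using assms j unfolding pairwise_incomparable_def by auto
  moreover have "\<zero> \<in> PIdl (a j)"
    using additive_subgroup.zero_closed ideal.axioms(1) cgenideal_ideal \<open>a j \<in> carrier R\<close> by metis
  ultimately show "a i \<noteq> \<zero>" by auto
qed

lemma (in cring) idealI_cring:
  assumes "I \<subseteq> carrier R" "\<zero> \<in> I"
    and add: "\<And>x y. \<lbrakk>x \<in> I; y \<in> I\<rbrakk> \<Longrightarrow> x \<oplus> y \<in> I"
    and mult: "\<And>r x. \<lbrakk>r \<in> carrier R; x \<in> I\<rbrakk> \<Longrightarrow> r \<otimes> x \<in> I"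
  shows "ideal I R"
proof (rule idealI[OF ring_axioms])
  have "\<ominus> x \<in> I" if "x \<in> I" for x
    using mult[of "\<ominus> \<one>" x] that assms(1) by (auto simp: l_minus)
  then show "subgroup I (add_monoid R)"
    by (intro add.subgroupI) (use assms in auto)
  show "\<And>a x. \<lbrakk>a \<in> I; x \<in> carrier R\<rbrakk> \<Longrightarrow> x \<otimes> a \<in> I" using mult .
  then show "\<And>a x. \<lbrakk>a \<in> I; x \<in> carrier R\<rbrakk> \<Longrightarrow> a \<otimes> x \<in> I"
    using m_comm assms(1) by (metis subsetD)
qed

section \<open>Scaling ideals of a subring\<close>

text \<open>The scalar \<open>s\<close> is taken from the large ring and need not lie in \<open>D\<close>; multiplication by it is
  still an isomorphism of \<open>D\<close>-modules from \<open>J\<close> onto \<open>s J\<close>, so it carries generating sets to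
  generating sets.\<close>

lemma (in domain) genideal_scale_iff:
  fixes D s
  defines "A \<equiv> R\<lparr>carrier := D\<rparr>"
  assumes D: "subring D R" and s: "s \<in> carrier R" "s \<noteq> \<zero>"
    and J: "ideal J A" and sJ: "(\<otimes>) s ` J \<subseteq> D" and G: "G \<subseteq> J"
  shows "(\<otimes>) s ` J = Idl\<^bsub>A\<^esub> ((\<otimes>) s ` G) \<longleftrightarrow> J = Idl\<^bsub>A\<^esub> G"
proof -
  interpret A: cring A
    unfolding A_def using subring_is_domain[OF D] by (simp add: domain_def)
  have A_simps [simp]: "carrier A = D" "x \<otimes>\<^bsub>A\<^esub> y = x \<otimes> y" "x \<oplus>\<^bsub>A\<^esub> y = x \<oplus> y" "\<zero>\<^bsub>A\<^esub> = \<zero>" for x y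
    by (simp_all add: A_def)
  have DR: "D \<subseteq> carrier R" by (rule subringE(1)[OF D])
  interpret J: ideal J A by fact
  have JD: "J \<subseteq> D" using J.Icarr by auto
  have scale: "ideal ((\<otimes>) s ` L) A" if L: "ideal L A" "L \<subseteq> J" for L
  proof -
    interpret L: ideal L A by fact
    have LR: "L \<subseteq> carrier R" using L JD DR by blast
    show ?thesis
    proof (rule A.idealI_cring)
      show "(\<otimes>) s ` L \<subseteq> carrier A" using L sJ by auto
      show "\<zero>\<^bsub>A\<^esub> \<in> (\<otimes>) s ` L" using L.zero_closed s by (auto intro: image_eqI[of _ _ \<zero>])
    next
      fix x y assume "x \<in> (\<otimes>) s ` L" "y \<in> (\<otimes>) s ` L"
      then obtain p q where pq: "p \<in> L" "q \<in> L" "x = s \<otimes> p" "y = s \<otimes> q" by blast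
      then have "x \<oplus>\<^bsub>A\<^esub> y = s \<otimes> (p \<oplus> q)" using LR s by (simp add: r_distr subset_eq)
      moreover have "p \<oplus> q \<in> L" using L.a_closed[OF pq(1,2)] by simp
      ultimately show "x \<oplus>\<^bsub>A\<^esub> y \<in> (\<otimes>) s ` L" by blast
    next
      fix r x assume "r \<in> carrier A" "x \<in> (\<otimes>) s ` L"
      then obtain p where p: "r \<in> D" "p \<in> L" "x = s \<otimes> p" by auto
      then have "r \<otimes>\<^bsub>A\<^esub> x = s \<otimes> (r \<otimes> p)"
        using LR DR s by (simp add: m_lcomm subset_eq)
      moreover have "r \<otimes> p \<in> L" using L.I_l_closed[OF p(2), of r] p(1) by simp
      ultimately show "r \<otimes>\<^bsub>A\<^esub> x \<in> (\<otimes>) s ` L" by blast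
    qed
  qed
  have GD: "G \<subseteq> carrier A" using G JD by simp
  have sGD: "(\<otimes>) s ` G \<subseteq> carrier A" using G sJ by auto
  have sub: "Idl\<^bsub>A\<^esub> G \<subseteq> J" by (rule A.genideal_minimal[OF J G])
  have "(\<otimes>) s ` G \<subseteq> (\<otimes>) s ` (Idl\<^bsub>A\<^esub> G)" using A.genideal_self[OF GD] by blast
  then have 1: "Idl\<^bsub>A\<^esub> ((\<otimes>) s ` G) \<subseteq> (\<otimes>) s ` (Idl\<^bsub>A\<^esub> G)"
    by (rule A.genideal_minimal[OF scale[OF A.genideal_ideal[OF GD] sub]])
  interpret I: ideal "Idl\<^bsub>A\<^esub> ((\<otimes>) s ` G)" A by (rule A.genideal_ideal[OF sGD])
  have "ideal {x \<in> J. s \<otimes> x \<in> Idl\<^bsub>A\<^esub> ((\<otimes>) s ` G)} A"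
  proof (rule A.idealI_cring)
    show "{x \<in> J. s \<otimes> x \<in> Idl\<^bsub>A\<^esub> ((\<otimes>) s ` G)} \<subseteq> carrier A" using JD by auto
    show "\<zero>\<^bsub>A\<^esub> \<in> {x \<in> J. s \<otimes> x \<in> Idl\<^bsub>A\<^esub> ((\<otimes>) s ` G)}"
      using J.zero_closed I.zero_closed s by simp
  next
    fix x y assume xy: "x \<in> {x \<in> J. s \<otimes> x \<in> Idl\<^bsub>A\<^esub> ((\<otimes>) s ` G)}" "y \<in> {x \<in> J. s \<otimes> x \<in> Idl\<^bsub>A\<^esub> ((\<otimes>) s ` G)}"
    then have "s \<otimes> (x \<oplus> y) = s \<otimes> x \<oplus> s \<otimes> y" using JD DR s by (simp add: r_distr subset_eq)
    then show "x \<oplus>\<^bsub>A\<^esub> y \<in> {x \<in> J. s \<otimes> x \<in> Idl\<^bsub>A\<^esub> ((\<otimes>) s ` G)}"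
      using xy J.a_closed[of x y] I.a_closed[of "s \<otimes> x" "s \<otimes> y"] by simp
  next
    fix r x assume rx: "r \<in> carrier A" "x \<in> {x \<in> J. s \<otimes> x \<in> Idl\<^bsub>A\<^esub> ((\<otimes>) s ` G)}"
    then have "s \<otimes> (r \<otimes> x) = r \<otimes> (s \<otimes> x)" using JD DR s by (simp add: m_lcomm subset_eq)
    then show "r \<otimes>\<^bsub>A\<^esub> x \<in> {x \<in> J. s \<otimes> x \<in> Idl\<^bsub>A\<^esub> ((\<otimes>) s ` G)}"
      using rx J.I_l_closed[of x r] I.I_l_closed[of "s \<otimes> x" r] by simp
  qed
  then have "Idl\<^bsub>A\<^esub> G \<subseteq> {x \<in> J. s \<otimes> x \<in> Idl\<^bsub>A\<^esub> ((\<otimes>) s ` G)}"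
    by (rule A.genideal_minimal) (use G A.genideal_self[OF sGD] in auto)
  then have eq: "Idl\<^bsub>A\<^esub> ((\<otimes>) s ` G) = (\<otimes>) s ` (Idl\<^bsub>A\<^esub> G)"
    using 1 by blast
  have "inj_on ((\<otimes>) s) J"
    using JD DR s m_lcancel by (intro inj_onI) (metis subsetD)
  then show ?thesis unfolding eq using sub by (simp add: inj_on_image_eq_iff)
qed

lemma (in domain)
  fixes D s
  defines "A \<equiv> R\<lparr>carrier := D\<rparr>"
  assumes D: "subring D R" and s: "s \<in> carrier R" "s \<noteq> \<zero>"
    and J: "ideal J A" and sJ: "(\<otimes>) s ` J \<subseteq> D"
  shows fin_gen_ideal_scale_iff: "fin_gen_ideal ((\<otimes>) s ` J) A \<longleftrightarrow> fin_gen_ideal J A"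
    and principalideal_scale_iff: "principalideal ((\<otimes>) s ` J) A \<longleftrightarrow> principalideal J A"
proof -
  interpret A: cring A
    unfolding A_def using subring_is_domain[OF D] by (simp add: domain_def)
  have [simp]: "carrier A = D" by (simp add: A_def)
  have JD: "J \<subseteq> D" using ideal.Icarr[OF J] by auto
  note scale = genideal_scale_iff[OF D s J[unfolded A_def] sJ, folded A_def]
  show "fin_gen_ideal ((\<otimes>) s ` J) A \<longleftrightarrow> fin_gen_ideal J A"
  proof
    assume "fin_gen_ideal ((\<otimes>) s ` J) A"
    then obtain H where H: "finite H" "H \<subseteq> carrier A" "(\<otimes>) s ` J = Idl\<^bsub>A\<^esub> H"
      unfolding fin_gen_ideal_def by blast
    then have "H \<subseteq> (\<otimes>) s ` J" using A.genideal_self by simp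
    then obtain G where G: "G \<subseteq> J" "finite G" "H = (\<otimes>) s ` G"
      using H(1) by (meson finite_subset_image)
    then have "J = Idl\<^bsub>A\<^esub> G" using scale[OF G(1)] H(3) by simp
    then show "fin_gen_ideal J A" unfolding fin_gen_ideal_def using G JD by auto
  next
    assume "fin_gen_ideal J A"
    then obtain G where G: "finite G" "G \<subseteq> carrier A" "J = Idl\<^bsub>A\<^esub> G"
      unfolding fin_gen_ideal_def by blast
    then have GJ: "G \<subseteq> J" using A.genideal_self by simp
    then have "(\<otimes>) s ` J = Idl\<^bsub>A\<^esub> ((\<otimes>) s ` G)" using scale G(3) by simp
    then show "fin_gen_ideal ((\<otimes>) s ` J) A"
      unfolding fin_gen_ideal_def using G(1) GJ sJ by (intro exI[of _ "(\<otimes>) s ` G"]) auto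
  qed
  show "principalideal ((\<otimes>) s ` J) A \<longleftrightarrow> principalideal J A"
  proof
    assume "principalideal ((\<otimes>) s ` J) A"
    then obtain y where y: "y \<in> carrier A" "(\<otimes>) s ` J = Idl\<^bsub>A\<^esub> {y}"
      unfolding A.principalideal_iff by blast
    then obtain x where x: "x \<in> J" "y = s \<otimes> x" using A.genideal_self'[OF y(1)] by blast
    then have "J = Idl\<^bsub>A\<^esub> {x}" using scale[of "{x}"] y(2) by simp
    then show "principalideal J A" unfolding A.principalideal_iff using x JD by auto
  next
    assume "principalideal J A"
    then obtain x where x: "x \<in> carrier A" "J = Idl\<^bsub>A\<^esub> {x}"
      unfolding A.principalideal_iff by blast
    then have xJ: "x \<in> J" using A.genideal_self' by simp
    then have "(\<otimes>) s ` J = Idl\<^bsub>A\<^esub> {s \<otimes> x}" using scale[of "{x}"] x(2) by simp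
    then show "principalideal ((\<otimes>) s ` J) A"
      unfolding A.principalideal_iff using xJ sJ by (intro bexI[of _ "s \<otimes> x"]) auto
  qed
qed

section \<open>Quotients by a divided prime\<close>

text \<open>A surjection whose kernel is a divided prime: the kernel is contained in every principal
  ideal that is not inside it. The projection \<open>D \<rightarrow> B\<close> is of this kind, and this property alone
  makes the divisibility theory of \<open>R\<close> outside the kernel the same as that of \<open>S\<close>.\<close>

locale divided_kernel = ring_hom_cring R S h + S?: "domain" S
  for R (structure) and S (structure) and h +
  assumes surj: "h ` carrier R = carrier S"
    and kernel_dvd: "\<lbrakk>a \<in> carrier R; h a \<noteq> \<zero>\<^bsub>S\<^esub>; y \<in> carrier R; h y = \<zero>\<^bsub>S\<^esub>\<rbrakk> \<Longrightarrow> y \<in> PIdl a"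
begin

lemma lift:
  assumes "s \<in> carrier S"
  obtains r where "r \<in> carrier R" "h r = s"
proof -
  have "s \<in> h ` carrier R" using assms by (simp only: surj)
  then show thesis using that by blast
qed

text \<open>A divisibility in \<open>S\<close> lifts to \<open>R\<close> up to an error in the kernel, and \<open>a\<close> divides that error.\<close>

lemma PIdl_image_iff:
  assumes a: "a \<in> carrier R" "h a \<noteq> \<zero>\<^bsub>S\<^esub>" and y: "y \<in> carrier R"
  shows "y \<in> PIdl a \<longleftrightarrow> h y \<in> PIdl\<^bsub>S\<^esub> (h a)"
proof
  show "y \<in> PIdl a \<Longrightarrow> h y \<in> PIdl\<^bsub>S\<^esub> (h a)"
    using a(1) unfolding cgenideal_def by auto
next
  assume "h y \<in> PIdl\<^bsub>S\<^esub> (h a)"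
  then obtain s where "s \<in> carrier S" "h y = s \<otimes>\<^bsub>S\<^esub> h a" unfolding cgenideal_def by blast
  then obtain r where r: "r \<in> carrier R" "h y = h (r \<otimes> a)"
    using lift a(1) by (metis hom_mult)
  interpret P: ideal "PIdl a" R by (rule R.cgenideal_ideal[OF a(1)])
  have "h (y \<ominus> r \<otimes> a) = \<zero>\<^bsub>S\<^esub>"
    using r a(1) y by (simp add: R.minus_eq S.r_neg)
  then have "y \<ominus> r \<otimes> a \<in> PIdl a" using kernel_dvd a y r(1) by simp
  moreover have "r \<otimes> a \<in> PIdl a" using r(1) unfolding cgenideal_def by blast
  ultimately have "y \<ominus> r \<otimes> a \<oplus> r \<otimes> a \<in> PIdl a" by (rule P.a_closed)
  moreover have "y \<ominus> r \<otimes> a \<oplus> r \<otimes> a = y" using y r(1) a(1) by algebra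
  ultimately show "y \<in> PIdl a" by simp
qed

lemma pairwise_incomparable_image_iff:
  assumes "\<And>i. i \<in> {1..n} \<Longrightarrow> a i \<in> carrier R \<and> h (a i) \<noteq> \<zero>\<^bsub>S\<^esub>"
  shows "pairwise_incomparable S n (h \<circ> a) \<longleftrightarrow> pairwise_incomparable R n a"
proof -
  have "a i \<in> PIdl (a j) \<longleftrightarrow> (h \<circ> a) i \<in> PIdl\<^bsub>S\<^esub> ((h \<circ> a) j)" if "i \<in> {1..n}" "j \<in> {1..n}" for i j
    unfolding comp_apply by (rule PIdl_image_iff) (use assms that in blast)+
  moreover have "a i \<in> carrier R" "(h \<circ> a) i \<in> carrier S" if "i \<in> {1..n}" for i
    using assms[OF that] by simp_all
  ultimately show ?thesis unfolding pairwise_incomparable_def by blast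
qed

lemma Inter_PIdl_eq_vimage:
  assumes "I \<noteq> {}" "\<And>i. i \<in> I \<Longrightarrow> a i \<in> carrier R \<and> h (a i) \<noteq> \<zero>\<^bsub>S\<^esub>"
  shows "(\<Inter>i\<in>I. PIdl (a i)) = {x \<in> carrier R. h x \<in> (\<Inter>i\<in>I. PIdl\<^bsub>S\<^esub> ((h \<circ> a) i))}"
proof -
  have "(\<Inter>i\<in>I. PIdl (a i)) \<subseteq> carrier R"
    using ideal.Icarr[OF R.Inter_PIdl_ideal[of I a]] assms by blast
  moreover have "y \<in> PIdl (a i) \<longleftrightarrow> h y \<in> PIdl\<^bsub>S\<^esub> ((h \<circ> a) i)" if "y \<in> carrier R" "i \<in> I" for y i
    unfolding comp_apply by (rule PIdl_image_iff) (use assms that in blast)+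
  ultimately show ?thesis by blast
qed

text \<open>As \<open>J\<close> is nonzero, a generating set on either side has a member with nonzero image. That member
  alone generates an ideal containing the kernel, so no generators of the kernel have to be added when lifting.\<close>

lemma genideal_vimage_iff:
  assumes J: "ideal J S" "s \<in> J" "s \<noteq> \<zero>\<^bsub>S\<^esub>" and G: "G \<subseteq> carrier R"
  shows "{x \<in> carrier R. h x \<in> J} = Idl G \<longleftrightarrow> J = Idl\<^bsub>S\<^esub> (h ` G)" (is "?I = _ \<longleftrightarrow> _")
proof
  have hG: "h ` G \<subseteq> carrier S" using G by auto
  have JS: "J \<subseteq> carrier S" using ideal.Icarr[OF J(1)] by blast
  {
    assume I: "?I = Idl G"
    have "h ` G \<subseteq> J" using R.genideal_self[OF G] I by blast
    then have "Idl\<^bsub>S\<^esub> (h ` G) \<subseteq> J" by (rule S.genideal_minimal[OF J(1)])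
    moreover have "Idl G \<subseteq> {x \<in> carrier R. h x \<in> Idl\<^bsub>S\<^esub> (h ` G)}"
      by (rule R.genideal_minimal[OF ring.ideal_vimage[OF S.genideal_ideal[OF hG]]])
        (use S.genideal_self[OF hG] G in auto)
    then have "h r \<in> Idl\<^bsub>S\<^esub> (h ` G)" if "r \<in> carrier R" "h r \<in> J" for r
      using I that by auto
    then have "J \<subseteq> Idl\<^bsub>S\<^esub> (h ` G)"
      using JS lift by (metis subsetD subsetI)
    ultimately show "J = Idl\<^bsub>S\<^esub> (h ` G)" by blast
  }
  assume JG: "J = Idl\<^bsub>S\<^esub> (h ` G)"
  interpret G: ideal "Idl G" R by (rule R.genideal_ideal[OF G])
  show "?I = Idl G"
  proof
    have "G \<subseteq> ?I" using G S.genideal_self[OF hG] JG by blast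
    then show "Idl G \<subseteq> ?I" by (rule R.genideal_minimal[OF ring.ideal_vimage[OF J(1)]])
  next
    obtain x where x: "x \<in> G" "h x \<noteq> \<zero>\<^bsub>S\<^esub>"
    proof (rule ccontr)
      assume "\<not> thesis"
      then have "h ` G \<subseteq> {\<zero>\<^bsub>S\<^esub>}" using that by blast
      then have "J \<subseteq> {\<zero>\<^bsub>S\<^esub>}" unfolding JG by (rule S.genideal_minimal[OF S.zeroideal])
      then show False using J(2,3) by blast
    qed
    have xG: "x \<in> Idl G" using R.genideal_self[OF G] x(1) by blast
    have ker: "y \<in> Idl G" if y: "y \<in> carrier R" "h y = \<zero>\<^bsub>S\<^esub>" for y
      using kernel_dvd[of x y] x y G R.cgenideal_minimal[OF G.is_ideal xG] by blast
    have "h ` G \<subseteq> h ` (Idl G)" using R.genideal_self[OF G] by blast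
    then have J_image: "J \<subseteq> h ` (Idl G)"
      unfolding JG by (rule S.genideal_minimal[OF ring.ideal_image[OF surj G.is_ideal]])
    show "?I \<subseteq> Idl G"
    proof
      fix y assume y: "y \<in> ?I"
      then obtain z where z: "z \<in> Idl G" "h y = h z" using J_image by auto
      have zc: "z \<in> carrier R" by (rule G.Icarr[OF z(1)])
      have "h (y \<ominus> z) = \<zero>\<^bsub>S\<^esub>" using y z zc by (simp add: R.minus_eq S.r_neg)
      then have "y \<ominus> z \<oplus> z \<in> Idl G" using ker y zc z(1) G.a_closed by simp
      moreover have "y \<ominus> z \<oplus> z = y" using y zc by (simp add: R.minus_eq R.a_assoc R.l_neg)
      ultimately show "y \<in> Idl G" by simp
    qed
  qed
qed

lemma fin_gen_ideal_vimage_iff: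
  assumes J: "ideal J S" "s \<in> J" "s \<noteq> \<zero>\<^bsub>S\<^esub>"
  shows "fin_gen_ideal {x \<in> carrier R. h x \<in> J} R \<longleftrightarrow> fin_gen_ideal J S"
proof
  assume "fin_gen_ideal {x \<in> carrier R. h x \<in> J} R"
  then obtain G where G: "finite G" "G \<subseteq> carrier R" "{x \<in> carrier R. h x \<in> J} = Idl G"
    unfolding fin_gen_ideal_def by blast
  have "J = Idl\<^bsub>S\<^esub> (h ` G)" by (rule iffD1[OF genideal_vimage_iff[OF J G(2)] G(3)])
  then show "fin_gen_ideal J S"
    unfolding fin_gen_ideal_def using G by (intro exI[of _ "h ` G"]) auto
next
  assume "fin_gen_ideal J S"
  then obtain Y where Y: "finite Y" "Y \<subseteq> h ` carrier R" "J = Idl\<^bsub>S\<^esub> Y"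
    unfolding fin_gen_ideal_def surj by blast
  then obtain G where G: "finite G" "G \<subseteq> carrier R" "Y = h ` G"
    by (meson finite_subset_image)
  have "{x \<in> carrier R. h x \<in> J} = Idl G"
    by (rule iffD2[OF genideal_vimage_iff[OF J G(2)] Y(3)[unfolded G(3)]])
  then show "fin_gen_ideal {x \<in> carrier R. h x \<in> J} R"
    unfolding fin_gen_ideal_def using G by (intro exI[of _ G]) simp
qed

lemma principalideal_vimage_iff:
  assumes J: "ideal J S" "s \<in> J" "s \<noteq> \<zero>\<^bsub>S\<^esub>"
  shows "principalideal {x \<in> carrier R. h x \<in> J} R \<longleftrightarrow> principalideal J S"
proof -
  have eq: "{x \<in> carrier R. h x \<in> J} = Idl {r} \<longleftrightarrow> J = Idl\<^bsub>S\<^esub> {h r}" if "r \<in> carrier R" for r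
  proof -
    have "{r} \<subseteq> carrier R" using that by simp
    from genideal_vimage_iff[OF J this] show ?thesis unfolding image_insert image_empty .
  qed
  show ?thesis
    unfolding R.principalideal_iff S.principalideal_iff
  proof
    assume "\<exists>r\<in>carrier R. {x \<in> carrier R. h x \<in> J} = Idl {r}"
    then obtain r where "r \<in> carrier R" "{x \<in> carrier R. h x \<in> J} = Idl {r}" ..
    then show "\<exists>t\<in>carrier S. J = Idl\<^bsub>S\<^esub> {t}" using eq hom_closed by metis
  next
    assume "\<exists>t\<in>carrier S. J = Idl\<^bsub>S\<^esub> {t}"
    then obtain t where t: "t \<in> carrier S" "J = Idl\<^bsub>S\<^esub> {t}" ..
    obtain r where r: "r \<in> carrier R" "h r = t" using lift[OF t(1)] .
    have "{x \<in> carrier R. h x \<in> J} = Idl {r}" using iffD2[OF eq[OF r(1), unfolded r(2)] t(2)] .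
    then show "\<exists>r\<in>carrier R. {x \<in> carrier R. h x \<in> J} = Idl {r}" using r(1) ..
  qed
qed

lemma Inter_PIdl_image:
  fixes n :: nat
  assumes "2 \<le> n" and a: "\<And>i. i \<in> {1..n} \<Longrightarrow> a i \<in> carrier R \<and> h (a i) \<noteq> \<zero>\<^bsub>S\<^esub>"
  shows "fin_gen_ideal (\<Inter>i\<in>{1..n}. PIdl (a i)) R \<longleftrightarrow>
      fin_gen_ideal (\<Inter>i\<in>{1..n}. PIdl\<^bsub>S\<^esub> ((h \<circ> a) i)) S" (is ?fg)
    and "principalideal (\<Inter>i\<in>{1..n}. PIdl (a i)) R \<longleftrightarrow>
      principalideal (\<Inter>i\<in>{1..n}. PIdl\<^bsub>S\<^esub> ((h \<circ> a) i)) S" (is ?pr)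
proof -
  let ?J = "\<Inter>i\<in>{1..n}. PIdl\<^bsub>S\<^esub> ((h \<circ> a) i)"
  have ne: "{1..n} \<noteq> {}" using \<open>2 \<le> n\<close> by simp
  have J: "ideal ?J S" by (rule S.Inter_PIdl_ideal[OF ne]) (use a in auto)
  obtain s where s: "s \<in> ?J" "s \<noteq> \<zero>\<^bsub>S\<^esub>"
    using S.Inter_PIdl_nonzero[of "{1..n}" "h \<circ> a"] a by auto
  have eq: "(\<Inter>i\<in>{1..n}. PIdl (a i)) = {x \<in> carrier R. h x \<in> ?J}"
    by (rule Inter_PIdl_eq_vimage[OF ne a])
  show ?fg
    unfolding eq by (rule fin_gen_ideal_vimage_iff[OF J s])
  show ?pr
    unfolding eq by (rule principalideal_vimage_iff[OF J s])
qed

end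

section \<open>Pullbacks along the residue map of a local domain\<close>

text \<open>The situation of the theorem with the residue field and the canonical map left abstract.
  Locality of \<open>T\<close> enters only as the invertibility of the elements outside the kernel of \<open>h\<close>.\<close>

locale pullback = T?: "domain" T + K?: field K + ring_hom_cring T K h
  for T (structure) and K (structure) and h and B +
  assumes h_surj: "h ` carrier T = carrier K"
    and nonkernel_Units: "\<lbrakk>x \<in> carrier T; h x \<noteq> \<zero>\<^bsub>K\<^esub>\<rbrakk> \<Longrightarrow> x \<in> Units T"
    and B: "subdomain B K"
    and fraction: "k \<in> carrier K \<Longrightarrow> \<exists>a\<in>B. \<exists>b\<in>B - {\<zero>\<^bsub>K\<^esub>}. k = a \<otimes>\<^bsub>K\<^esub> inv\<^bsub>K\<^esub> b"
begin

definition D where "D = {x \<in> carrier T. h x \<in> B}"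

abbreviation D_ring where "D_ring \<equiv> T\<lparr>carrier := D\<rparr>"

abbreviation B_ring where "B_ring \<equiv> K\<lparr>carrier := B\<rparr>"

lemma D_subset: "D \<subseteq> carrier T"
  by (auto simp: D_def)

lemma D_subring: "subring D T"
  by (rule T.subringI) (use subdomainE[OF B] in \<open>auto simp: D_def\<close>)

lemma nonkernel_divides:
  assumes a: "a \<in> carrier T" "h a \<noteq> \<zero>\<^bsub>K\<^esub>" and y: "y \<in> carrier T" "h y = \<zero>\<^bsub>K\<^esub>"
  obtains d where "d \<in> D" "y = d \<otimes> a"
proof
  have u: "a \<in> Units T" by (rule nonkernel_Units[OF a])
  have "h (y \<otimes> inv a) = \<zero>\<^bsub>K\<^esub>" using y u by simp
  then show "y \<otimes> inv a \<in> D"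
    using y u subdomainE(2)[OF B] by (simp add: D_def)
  show "y = y \<otimes> inv a \<otimes> a" using y u a by (simp add: T.m_assoc)
qed

sublocale DB: divided_kernel D_ring B_ring h
proof -
  interpret A: "domain" D_ring by (rule T.subring_is_domain[OF D_subring])
  interpret B: "domain" B_ring by (rule K.subdomain_is_domain[OF B])
  show "divided_kernel D_ring B_ring h"
  proof
    show "h \<in> ring_hom D_ring B_ring"
      by (rule ring_hom_memI) (auto simp: D_def)
    show "h ` carrier D_ring = carrier B_ring"
    proof
      show "h ` carrier D_ring \<subseteq> carrier B_ring" by (auto simp: D_def)
      show "carrier B_ring \<subseteq> h ` carrier D_ring"
      proof
        fix b assume b: "b \<in> carrier B_ring"
        then have "b \<in> h ` carrier T" using h_surj subdomainE(1)[OF B] by auto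
        then show "b \<in> h ` carrier D_ring" using b by (auto simp: D_def)
      qed
    qed
    show "y \<in> PIdl\<^bsub>D_ring\<^esub> a"
      if "a \<in> carrier D_ring" "h a \<noteq> \<zero>\<^bsub>B_ring\<^esub>" "y \<in> carrier D_ring" "h y = \<zero>\<^bsub>B_ring\<^esub>" for a y
      using nonkernel_divides[of a y] that D_subset unfolding cgenideal_def by auto
  qed
qed

lemma PIdl_D: "x \<in> PIdl\<^bsub>D_ring\<^esub> a \<longleftrightarrow> (\<exists>d\<in>D. x = d \<otimes> a)"
  unfolding cgenideal_def by auto

lemma lift_B: "b \<in> B \<Longrightarrow> \<exists>d\<in>D. h d = b"
proof -
  assume "b \<in> B"
  then have "b \<in> h ` carrier D_ring" unfolding DB.surj by simp
  then show ?thesis by auto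
qed

text \<open>The ratios \<open>h (u i)\<close> are fractions over \<open>B\<close>; denominators are multiplied up one at a time.\<close>

lemma common_denominator:
  assumes "finite I" "\<And>i. i \<in> I \<Longrightarrow> u i \<in> carrier T"
  shows "\<exists>c\<in>D. h c \<noteq> \<zero>\<^bsub>K\<^esub> \<and> (\<forall>i\<in>I. c \<otimes> u i \<in> D)"
  using assms
proof (induction I rule: finite_induct)
  case empty
  have "\<one> \<in> D" using subringE(3)[OF D_subring] .
  then show ?case by (intro bexI[of _ \<one>]) simp_all
next
  case (insert j I)
  then obtain c where c: "c \<in> D" "h c \<noteq> \<zero>\<^bsub>K\<^esub>" "\<And>i. i \<in> I \<Longrightarrow> c \<otimes> u i \<in> D" by auto
  have uj: "u j \<in> carrier T" using insert.prems by simp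
  obtain p q where pq: "p \<in> B" "q \<in> B" "q \<noteq> \<zero>\<^bsub>K\<^esub>" "h (u j) = p \<otimes>\<^bsub>K\<^esub> inv\<^bsub>K\<^esub> q"
    using fraction[OF hom_closed[OF uj]] by blast
  have pqK: "p \<in> carrier K" "q \<in> carrier K" using pq subdomainE(1)[OF B] by auto
  obtain e where e: "e \<in> D" "h e = q" using lift_B[OF pq(2)] by blast
  note carr = subsetD[OF D_subset c(1)] subsetD[OF D_subset e(1)]
  have "q \<in> Units K" using K.field_Units pq(3) pqK(2) by simp
  then have "h (e \<otimes> u j) = p"
    using carr uj e(2) pq(4) pqK K.m_lcomm[of q p "inv\<^bsub>K\<^esub> q"] by simp
  then have ej: "e \<otimes> u j \<in> D" using pq(1) carr uj by (simp add: D_def)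
  note D_mult = subringE(6)[OF D_subring]
  have "e \<otimes> c \<otimes> u i \<in> D" if "i \<in> insert j I" for i
  proof (cases "i = j")
    case True
    have "e \<otimes> c \<otimes> u j = c \<otimes> (e \<otimes> u j)" using carr uj by algebra
    then show ?thesis using D_mult[OF c(1) ej] True by simp
  next
    case False
    then have i: "i \<in> I" using that by simp
    then have "e \<otimes> c \<otimes> u i = e \<otimes> (c \<otimes> u i)"
      using T.m_assoc[OF carr(2,1)] insert.prems by simp
    then show ?thesis using D_mult[OF e(1) c(3)[OF i]] by simp
  qed
  moreover have "h (e \<otimes> c) \<noteq> \<zero>\<^bsub>K\<^esub>"
    using carr e(2) pq(3) pqK c(2) K.integral_iff[of q "h c"] by simp
  moreover have "e \<otimes> c \<in> D" using D_mult e(1) c(1) by blast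
  ultimately show ?case by blast
qed

lemma incomparable_family_D:
  assumes "pairwise_incomparable D_ring n a" "i \<in> {1..n}"
  shows "a i \<in> D" "a i \<in> carrier T" "a i \<noteq> \<zero>"
proof -
  show "a i \<in> D" "a i \<noteq> \<zero>" using DB.R.incomparable_nonzero[OF assms] by simp_all
  then show "a i \<in> carrier T" using D_subset by blast
qed

text \<open>After scaling by a common denominator the family is a multiple \<open>s \<otimes> v i\<close> of a family of elements
  of \<open>D\<close> outside the kernel, whose images in \<open>B\<close> are the family sought.\<close>

lemma associated_family_descends:
  assumes a: "pairwise_incomparable D_ring n a"
    and u: "\<And>i. i \<in> {1..n} \<Longrightarrow> u i \<in> Units T \<and> a i = u i \<otimes> a 1"
  obtains b where "pairwise_incomparable B_ring n b"
    "fin_gen_ideal (\<Inter>i\<in>{1..n}. PIdl\<^bsub>D_ring\<^esub> (a i)) D_ring \<longleftrightarrow>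
     fin_gen_ideal (\<Inter>i\<in>{1..n}. PIdl\<^bsub>B_ring\<^esub> (b i)) B_ring"
    "principalideal (\<Inter>i\<in>{1..n}. PIdl\<^bsub>D_ring\<^esub> (a i)) D_ring \<longleftrightarrow>
     principalideal (\<Inter>i\<in>{1..n}. PIdl\<^bsub>B_ring\<^esub> (b i)) B_ring"
proof -
  have n: "2 \<le> n" using a unfolding pairwise_incomparable_def by blast
  then have one: "1 \<in> {1..n}" by simp
  have uT: "u i \<in> carrier T" if "i \<in> {1..n}" for i using u[OF that] by blast
  obtain c where c: "c \<in> D" "h c \<noteq> \<zero>\<^bsub>K\<^esub>" "\<And>i. i \<in> {1..n} \<Longrightarrow> c \<otimes> u i \<in> D"
    using common_denominator[of "{1..n}" u] uT by auto
  have cT: "c \<in> carrier T" and cu: "c \<in> Units T"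
    using c D_subset nonkernel_Units by auto
  \<comment> \<open>The two factors are chosen so that \<open>v i\<close> lies in \<open>D\<close> and is a unit of \<open>T\<close>; only \<open>s\<close> may leave \<open>D\<close>.\<close>
  define v where "v i = c \<otimes> u i" for i
  define s where "s = inv c \<otimes> a 1"
  note a1 = incomparable_family_D[OF a one]
  have "c \<otimes> s = a 1" unfolding s_def using cu cT a1(2) by (simp add: T.m_assoc[symmetric])
  then have s: "s \<in> carrier T" "s \<noteq> \<zero>"
    using cu cT a1 by (auto simp: s_def)
  have vD: "v i \<in> D" and vT: "v i \<in> carrier T" if "i \<in> {1..n}" for i
    using c(3)[OF that] D_subset by (auto simp: v_def)
  have av: "a i = s \<otimes> v i" if i: "i \<in> {1..n}" for i
  proof -
    have "s \<otimes> v i = (c \<otimes> inv c) \<otimes> (u i \<otimes> a 1)"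
      unfolding s_def v_def using cT T.Units_inv_closed[OF cu] uT[OF i] a1(2) by algebra
    then show ?thesis using cu uT[OF i] a1(2) u[OF i] by simp
  qed
  have hv: "h (v i) \<noteq> \<zero>\<^bsub>K\<^esub>" if i: "i \<in> {1..n}" for i
  proof -
    have "h (u i) \<otimes>\<^bsub>K\<^esub> h (inv (u i)) = \<one>\<^bsub>K\<^esub>"
      using u[OF i] T.Units_inv_closed uT[OF i] by (metis T.Units_r_inv hom_mult hom_one)
    then have "h (u i) \<noteq> \<zero>\<^bsub>K\<^esub>" using u[OF i] by auto
    then show ?thesis using c(2) cT uT[OF i] K.integral_iff by (simp add: v_def)
  qed
  let ?I = "\<Inter>i\<in>{1..n}. PIdl\<^bsub>D_ring\<^esub> (a i)"
  let ?J = "\<Inter>i\<in>{1..n}. PIdl\<^bsub>D_ring\<^esub> (v i)"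
  have PIdl_a: "s \<otimes> x \<in> PIdl\<^bsub>D_ring\<^esub> (a i) \<longleftrightarrow> x \<in> PIdl\<^bsub>D_ring\<^esub> (v i)"
    if i: "i \<in> {1..n}" and x: "x \<in> carrier T" for i x
  proof -
    have "s \<otimes> x = d \<otimes> a i \<longleftrightarrow> x = d \<otimes> v i" if "d \<in> D" for d
    proof -
      have d: "d \<in> carrier T" using that D_subset by blast
      have "d \<otimes> a i = s \<otimes> (d \<otimes> v i)"
        unfolding av[OF i] using d s vT[OF i] by (simp add: T.m_lcomm)
      then show ?thesis using T.m_lcancel[OF s(2,1)] x d vT[OF i] by simp
    qed
    then show ?thesis unfolding PIdl_D by blast
  qed
  have inc: "pairwise_incomparable D_ring n v"
    unfolding pairwise_incomparable_def
  proof (intro conjI ballI impI n)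
    show "v i \<in> carrier D_ring" if "i \<in> {1..n}" for i using vD[OF that] by simp
    show "v i \<notin> PIdl\<^bsub>D_ring\<^esub> (v j)" if "i \<in> {1..n}" "j \<in> {1..n}" "i \<noteq> j" for i j
      using a that PIdl_a[OF that(2) vT[OF that(1)]]
      unfolding pairwise_incomparable_def av[OF that(1), symmetric] by blast
  qed
  have J: "ideal ?J D_ring"
    by (rule DB.R.Inter_PIdl_ideal) (use one vD in auto)
  have JD: "?J \<subseteq> D" using ideal.Icarr[OF J] by (intro subsetI) simp
  have IJ: "?I = (\<otimes>) s ` ?J"
  proof
    show "(\<otimes>) s ` ?J \<subseteq> ?I"
    proof
      fix y assume "y \<in> (\<otimes>) s ` ?J"
      then obtain x where x: "x \<in> ?J" "y = s \<otimes> x" by blast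
      then have "x \<in> carrier T" using JD D_subset by blast
      then have "y \<in> PIdl\<^bsub>D_ring\<^esub> (a i)" if "i \<in> {1..n}" for i
        unfolding x(2) using PIdl_a[OF that] INT_D[OF x(1) that] by blast
      then show "y \<in> ?I" by (rule INT_I)
    qed
    show "?I \<subseteq> (\<otimes>) s ` ?J"
    proof
      fix y assume y: "y \<in> ?I"
      obtain d where d: "d \<in> D" "y = d \<otimes> a 1" using INT_D[OF y one] unfolding PIdl_D by blast
      have dT: "d \<in> carrier T" using d(1) D_subset by blast
      have y_eq: "y = s \<otimes> (d \<otimes> v 1)"
        unfolding d(2) av[OF one] using dT s vT[OF one] by (simp add: T.m_lcomm)
      have "d \<otimes> v 1 \<in> PIdl\<^bsub>D_ring\<^esub> (v i)" if "i \<in> {1..n}" for i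
        using PIdl_a[OF that T.m_closed[OF dT vT[OF one]]] INT_D[OF y that] unfolding y_eq by blast
      then have "d \<otimes> v 1 \<in> ?J" by (rule INT_I)
      then show "y \<in> (\<otimes>) s ` ?J" using y_eq by blast
    qed
  qed
  have ID: "(\<otimes>) s ` ?J \<subseteq> D"
  proof -
    have "ideal ?I D_ring"
      by (rule DB.R.Inter_PIdl_ideal) (use one incomparable_family_D(1)[OF a] in auto)
    from ideal.Icarr[OF this] show ?thesis unfolding IJ by (intro subsetI) simp
  qed
  have v: "v i \<in> carrier D_ring \<and> h (v i) \<noteq> \<zero>\<^bsub>B_ring\<^esub>" if "i \<in> {1..n}" for i
    using vD[OF that] hv[OF that] by simp
  show thesis
  proof (rule that)
    show "pairwise_incomparable B_ring n (h \<circ> v)"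
      using DB.pairwise_incomparable_image_iff[of n v, OF v] inc by blast
    show "fin_gen_ideal ?I D_ring \<longleftrightarrow> fin_gen_ideal (\<Inter>i\<in>{1..n}. PIdl\<^bsub>B_ring\<^esub> ((h \<circ> v) i)) B_ring"
      unfolding IJ T.fin_gen_ideal_scale_iff[OF D_subring s J ID]
      by (rule DB.Inter_PIdl_image(1)[of n v, OF n v])
    show "principalideal ?I D_ring \<longleftrightarrow> principalideal (\<Inter>i\<in>{1..n}. PIdl\<^bsub>B_ring\<^esub> ((h \<circ> v) i)) B_ring"
      unfolding IJ T.principalideal_scale_iff[OF D_subring s J ID]
      by (rule DB.Inter_PIdl_image(2)[of n v, OF n v])
  qed
qed

text \<open>Here all cofactors of elements of the intersection lie in the kernel, so the intersection is
  stable under multiplication by \<open>T\<close>. It is then divisible in \<open>D\<close> by a nonunit of \<open>D\<close> that is a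
  unit of \<open>T\<close>, which a nonzero finitely generated ideal cannot be.\<close>

lemma nonassociated_family_not_fin_gen:
  assumes a: "pairwise_incomparable D_ring n a"
    and k: "k \<in> {1..n}" "\<And>w. w \<in> Units T \<Longrightarrow> a k \<noteq> w \<otimes> a 1"
    and BK: "B \<noteq> carrier K"
  shows "\<not> fin_gen_ideal (\<Inter>i\<in>{1..n}. PIdl\<^bsub>D_ring\<^esub> (a i)) D_ring" (is "\<not> fin_gen_ideal ?I _")
proof
  assume fg: "fin_gen_ideal ?I D_ring"
  have n: "2 \<le> n" using a unfolding pairwise_incomparable_def by blast
  then have one: "1 \<in> {1..n}" by simp
  note aD = incomparable_family_D[OF a]
  \<comment> \<open>A cofactor outside the kernel would make every \<open>a j\<close> divide \<open>a i\<close> in \<open>T\<close>; incomparability then forces unit cofactors, so all members would be associates.\<close>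
  have cofactor_in_kernel: "h d = \<zero>\<^bsub>K\<^esub>"
    if y: "d \<otimes> a i \<in> ?I" and i: "i \<in> {1..n}" and d: "d \<in> D" for d i
  proof (rule ccontr)
    assume hd: "h d \<noteq> \<zero>\<^bsub>K\<^esub>"
    have dT: "d \<in> carrier T" using d D_subset by blast
    have du: "d \<in> Units T" by (rule nonkernel_Units[OF dT hd])
    have "\<exists>w\<in>Units T. a i = w \<otimes> a j" if j: "j \<in> {1..n}" for j
    proof (cases "i = j")
      case True then show ?thesis using aD(2)[OF j] by (intro bexI[of _ \<one>]) auto
    next
      case False
      have "d \<otimes> a i \<in> PIdl\<^bsub>D_ring\<^esub> (a j)" using y j by (rule INT_D)
      then obtain f where f: "f \<in> D" "d \<otimes> a i = f \<otimes> a j" unfolding PIdl_D by blast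
      have fT: "f \<in> carrier T" using f(1) D_subset by blast
      have dfT: "inv d \<otimes> f \<in> carrier T" using du fT by simp
      have "a i = inv d \<otimes> (d \<otimes> a i)"
        using du dT aD(2)[OF i] by (simp add: T.m_assoc[symmetric])
      then have eq: "a i = (inv d \<otimes> f) \<otimes> a j"
        unfolding f(2) using du fT aD(2)[OF j] by (simp add: T.m_assoc)
      have "a i \<notin> PIdl\<^bsub>D_ring\<^esub> (a j)"
        using a i j False unfolding pairwise_incomparable_def by blast
      then have "inv d \<otimes> f \<notin> D" using eq unfolding PIdl_D by blast
      then have "h (inv d \<otimes> f) \<noteq> \<zero>\<^bsub>K\<^esub>"
        using dfT subdomainE(2)[OF B] by (auto simp: D_def simp del: hom_mult)
      then show ?thesis using nonkernel_Units[OF dfT] eq by blast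
    qed
    then obtain w w' where w: "w \<in> Units T" "a i = w \<otimes> a 1" and w': "w' \<in> Units T" "a i = w' \<otimes> a k"
      using one k(1) by blast
    have wT: "w \<in> carrier T" "w' \<in> carrier T" "inv w' \<in> carrier T" using w(1) w'(1) by auto
    have "a k = inv w' \<otimes> (w' \<otimes> a k)"
      using w'(1) wT aD(2)[OF k(1)] by (simp add: T.m_assoc[symmetric])
    also have "\<dots> = inv w' \<otimes> w \<otimes> a 1"
      using w(2) w'(2) wT aD(2)[OF one] by (simp add: T.m_assoc)
    finally have "a k = inv w' \<otimes> w \<otimes> a 1" .
    moreover have "inv w' \<otimes> w \<in> Units T"
      using w(1) w'(1) by (intro T.Units_m_closed T.Units_inv_Units)
    ultimately show False using k(2) by blast
  qed
  \<comment> \<open>\<open>B\<close> contains a nonzero nonunit, as otherwise it would contain all its fractions.\<close>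
  have "\<not> (\<forall>b\<in>B - {\<zero>\<^bsub>K\<^esub>}. inv\<^bsub>K\<^esub> b \<in> B)"
  proof
    assume inv: "\<forall>b\<in>B - {\<zero>\<^bsub>K\<^esub>}. inv\<^bsub>K\<^esub> b \<in> B"
    have "x \<in> B" if "x \<in> carrier K" for x
      using fraction[OF that] inv subdomainE(6)[OF B] by blast
    then show False using BK subdomainE(1)[OF B] by blast
  qed
  then obtain b where b: "b \<in> B" "b \<noteq> \<zero>\<^bsub>K\<^esub>" "inv\<^bsub>K\<^esub> b \<notin> B" by blast
  obtain c where c: "c \<in> D" "h c = b" using lift_B[OF b(1)] by blast
  have cT: "c \<in> carrier T" using c(1) D_subset by blast
  have cu: "c \<in> Units T" using nonkernel_Units[OF cT] c(2) b(2) by simp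
  \<comment> \<open>Dividing by \<open>c\<close> in \<open>T\<close> stays in \<open>D\<close> because the cofactors stay in the kernel.\<close>
  have div: "\<exists>z\<in>?I. y = c \<otimes> z" if y: "y \<in> ?I" for y
  proof
    have yT: "y \<in> carrier T"
    proof -
      obtain d where "d \<in> D" "y = d \<otimes> a 1" using INT_D[OF y one] unfolding PIdl_D by blast
      then show ?thesis using aD(2)[OF one] D_subset by auto
    qed
    show "y = c \<otimes> (inv c \<otimes> y)" using cT cu yT by (simp add: T.m_assoc[symmetric])
    show "inv c \<otimes> y \<in> ?I"
    proof
      fix i assume i: "i \<in> {1..n}"
      obtain d where d: "d \<in> D" "y = d \<otimes> a i" using INT_D[OF y i] unfolding PIdl_D by blast
      have dT: "d \<in> carrier T" using d(1) D_subset by blast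
      have "h d = \<zero>\<^bsub>K\<^esub>" using cofactor_in_kernel[OF _ i d(1)] y d(2) by blast
      then have "inv c \<otimes> d \<in> D"
        using dT cu subdomainE(2)[OF B] by (simp add: D_def)
      moreover have "inv c \<otimes> y = inv c \<otimes> d \<otimes> a i"
        using d(2) dT cu aD(2)[OF i] by (simp add: T.m_assoc)
      ultimately show "inv c \<otimes> y \<in> PIdl\<^bsub>D_ring\<^esub> (a i)" unfolding PIdl_D by blast
    qed
  qed
  interpret DR: "domain" D_ring by (rule T.subring_is_domain[OF D_subring])
  obtain y where y: "y \<noteq> \<zero>" "y \<in> ?I"
    using DR.Inter_PIdl_nonzero[of "{1..n}" a] aD by auto
  have "c \<in> Units D_ring"
    using DR.divisor_of_fin_gen_ideal_is_unit[OF fg y(2), of c] y(1) c(1) div by simp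
  then obtain e where e: "e \<in> D" "c \<otimes> e = \<one>" unfolding Units_def by auto
  have eT: "e \<in> carrier T" and eB: "h e \<in> B" using e(1) by (auto simp: D_def)
  have "b \<otimes>\<^bsub>K\<^esub> h e = \<one>\<^bsub>K\<^esub>" using e(2) eT cT c(2) by (metis hom_mult hom_one)
  moreover have "b \<in> carrier K" using c(2) cT by auto
  ultimately have "inv\<^bsub>K\<^esub> b = h e" using eT by (intro K.comm_inv_char) auto
  then show False using b(3) eB by simp
qed

text \<open>A family that is not associated in \<open>T\<close> cannot consist of units of \<open>T\<close>. Its nonunit members are
  nonzero elements of the kernel, so the hypothesis on \<open>B\<close> applies and the intersection is not
  finitely generated. What remains is the associated case.\<close>

lemma incomparable_family_descends:
  assumes a: "pairwise_incomparable D_ring n a"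
    and BK: "{x \<in> carrier T. h x = \<zero>\<^bsub>K\<^esub>} \<noteq> {\<zero>} \<Longrightarrow> B \<noteq> carrier K"
    and fg: "fin_gen_ideal (\<Inter>i\<in>{1..n}. PIdl\<^bsub>D_ring\<^esub> (a i)) D_ring"
  obtains b where "pairwise_incomparable B_ring n b"
    "fin_gen_ideal (\<Inter>i\<in>{1..n}. PIdl\<^bsub>B_ring\<^esub> (b i)) B_ring"
    "principalideal (\<Inter>i\<in>{1..n}. PIdl\<^bsub>B_ring\<^esub> (b i)) B_ring \<Longrightarrow>
     principalideal (\<Inter>i\<in>{1..n}. PIdl\<^bsub>D_ring\<^esub> (a i)) D_ring"
proof (cases "\<forall>i\<in>{1..n}. \<exists>w\<in>Units T. a i = w \<otimes> a 1")
  case True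
  then obtain u where u: "\<And>i. i \<in> {1..n} \<Longrightarrow> u i \<in> Units T \<and> a i = u i \<otimes> a 1" by metis
  show thesis by (rule associated_family_descends[OF a u]) (use that fg in blast)+
next
  case False
  then obtain k where k: "k \<in> {1..n}" "\<And>w. w \<in> Units T \<Longrightarrow> a k \<noteq> w \<otimes> a 1" by blast
  then have one: "1 \<in> {1..n}" by simp
  have "{x \<in> carrier T. h x = \<zero>\<^bsub>K\<^esub>} \<noteq> {\<zero>}"
  proof
    assume inj: "{x \<in> carrier T. h x = \<zero>\<^bsub>K\<^esub>} = {\<zero>}"
    have u: "a i \<in> Units T" if "i \<in> {1..n}" for i
      using nonkernel_Units incomparable_family_D[OF a that] inj by blast
    have "a k = a k \<otimes> inv (a 1) \<otimes> a 1"
      using u[OF k(1)] u[OF one] T.Units_closed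
      by (simp only: T.m_assoc T.Units_inv_closed T.Units_l_inv T.r_one)
    moreover have "a k \<otimes> inv (a 1) \<in> Units T"
      using u[OF k(1)] u[OF one] by (intro T.Units_m_closed T.Units_inv_Units)
    ultimately show False using k(2) by blast
  qed
  then have False using nonassociated_family_not_fin_gen[OF a k BK] fg by blast
  then show thesis ..
qed

text \<open>Any choice of preimages works: the members of an incomparable family are nonzero, so the
  preimages avoid the kernel.\<close>

lemma incomparable_family_lifts:
  assumes b: "pairwise_incomparable B_ring n b"
  obtains a where "pairwise_incomparable D_ring n a"
    "fin_gen_ideal (\<Inter>i\<in>{1..n}. PIdl\<^bsub>D_ring\<^esub> (a i)) D_ring \<longleftrightarrow>
     fin_gen_ideal (\<Inter>i\<in>{1..n}. PIdl\<^bsub>B_ring\<^esub> (b i)) B_ring"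
    "principalideal (\<Inter>i\<in>{1..n}. PIdl\<^bsub>D_ring\<^esub> (a i)) D_ring \<longleftrightarrow>
     principalideal (\<Inter>i\<in>{1..n}. PIdl\<^bsub>B_ring\<^esub> (b i)) B_ring"
proof -
  have n: "2 \<le> n" using b unfolding pairwise_incomparable_def by blast
  have "\<exists>r\<in>D. h r = b i" if "i \<in> {1..n}" for i
    using lift_B[of "b i"] DB.S.incomparable_nonzero(1)[OF b that] by simp
  then obtain f where f: "\<And>i. i \<in> {1..n} \<Longrightarrow> f i \<in> D \<and> h (f i) = b i" by metis
  have nz: "b i \<noteq> \<zero>\<^bsub>K\<^esub>" if "i \<in> {1..n}" for i
    using DB.S.incomparable_nonzero(2)[OF b that] by simp
  have a: "f i \<in> carrier D_ring \<and> h (f i) \<noteq> \<zero>\<^bsub>B_ring\<^esub>" if "i \<in> {1..n}" for i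
    using f[OF that] nz[OF that] by simp
  have PIdl_eq: "PIdl\<^bsub>B_ring\<^esub> ((h \<circ> f) i) = PIdl\<^bsub>B_ring\<^esub> (b i)" if "i \<in> {1..n}" for i
    using f[OF that] by simp
  then have eq: "(\<Inter>i\<in>{1..n}. PIdl\<^bsub>B_ring\<^esub> ((h \<circ> f) i)) = (\<Inter>i\<in>{1..n}. PIdl\<^bsub>B_ring\<^esub> (b i))"
    by simp
  have "pairwise_incomparable B_ring n (h \<circ> f)"
    using b f unfolding pairwise_incomparable_def by (simp add: PIdl_eq[unfolded comp_apply])
  then have "pairwise_incomparable D_ring n f"
    using DB.pairwise_incomparable_image_iff[of n f, OF a] by blast
  then show thesis
    using that[of f] DB.Inter_PIdl_image[of n f, OF n a] unfolding eq by blast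
qed

theorem BID_iff_and_SBID_iff:
  assumes BK: "{x \<in> carrier T. h x = \<zero>\<^bsub>K\<^esub>} \<noteq> {\<zero>} \<Longrightarrow> B \<noteq> carrier K"
  shows "(BID D_ring \<longleftrightarrow> BID B_ring) \<and> (SBID D_ring \<longleftrightarrow> SBID B_ring)"
proof -
  have dom: "domain D_ring" "domain B_ring"
    by (rule T.subring_is_domain[OF D_subring], rule K.subdomain_is_domain[OF B])
  let ?fg = "\<lambda>A n a. fin_gen_ideal (\<Inter>i\<in>{1..n}. PIdl\<^bsub>A\<^esub> (a i)) A"
  let ?pr = "\<lambda>A n a. principalideal (\<Inter>i\<in>{1..n}. PIdl\<^bsub>A\<^esub> (a i)) A"
  have descend: "\<exists>b. pairwise_incomparable B_ring n b \<and> ?fg B_ring n b \<and> (?pr B_ring n b \<longrightarrow> ?pr D_ring n a)"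
    if "pairwise_incomparable D_ring n a" "?fg D_ring n a" for n :: nat and a
    by (rule incomparable_family_descends[OF that(1) BK that(2)]) blast+
  have lifts: "\<exists>a. pairwise_incomparable D_ring n a \<and> (?fg D_ring n a \<longleftrightarrow> ?fg B_ring n b) \<and>
      (?pr D_ring n a \<longleftrightarrow> ?pr B_ring n b)"
    if "pairwise_incomparable B_ring n b" for n :: nat and b
    by (rule incomparable_family_lifts[OF that]) blast
  have "BID D_ring \<Longrightarrow> BID B_ring" "SBID D_ring \<Longrightarrow> SBID B_ring"
    unfolding BID_def SBID_def using dom(2) lifts by meson+
  moreover have "BID B_ring \<Longrightarrow> BID D_ring" "SBID B_ring \<Longrightarrow> SBID D_ring"
    unfolding BID_def SBID_def using dom(1) descend by meson+
  ultimately show ?thesis by blast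
qed

end

section \<open>Intersection domains and pullbacks\<close>

text \<open>An element outside \<open>m\<close> lies in no maximal ideal, hence is a unit.\<close>

lemma local_domain_pullback:
  assumes "local_domain T m" and "has_quotient_field B (T Quot m)"
  shows "pullback T (T Quot m) ((+>\<^bsub>T\<^esub>) m) B"
    and "{x \<in> carrier T. m +>\<^bsub>T\<^esub> x = \<zero>\<^bsub>T Quot m\<^esub>} = m"
proof -
  have T: "domain T" and m: "maximalideal m T" and unique: "\<And>J. maximalideal J T \<Longrightarrow> J = m"
    using assms(1) unfolding local_domain_def by blast+
  have K: "field (T Quot m)" and B: "subdomain B (T Quot m)"
    and frac: "\<And>k. k \<in> carrier (T Quot m) \<Longrightarrow> \<exists>a\<in>B. \<exists>b\<in>B - {\<zero>\<^bsub>T Quot m\<^esub>}.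
      k = a \<otimes>\<^bsub>T Quot m\<^esub> inv\<^bsub>T Quot m\<^esub> b"
    using assms(2) unfolding has_quotient_field_def by blast+
  interpret T: "domain" T by (rule T)
  interpret m: maximalideal m T by (rule m)
  have zero: "\<zero>\<^bsub>T Quot m\<^esub> = m" unfolding FactRing_def by simp
  have ker: "m +>\<^bsub>T\<^esub> x = \<zero>\<^bsub>T Quot m\<^esub> \<longleftrightarrow> x \<in> m" if "x \<in> carrier T" for x
    unfolding zero using T.a_rcos_zero[OF m.is_ideal] m.rcos_const_imp_mem[OF that] by blast
  then show "{x \<in> carrier T. m +>\<^bsub>T\<^esub> x = \<zero>\<^bsub>T Quot m\<^esub>} = m"
    using m.Icarr by blast
  show "pullback T (T Quot m) ((+>\<^bsub>T\<^esub>) m) B"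
  proof (rule pullback.intro[OF T K m.rcos_ring_hom_cring[OF T.is_cring] pullback_axioms.intro])
    show "(+>\<^bsub>T\<^esub>) m ` carrier T = carrier (T Quot m)"
      unfolding FactRing_def A_RCOSETS_def' by auto
    show "x \<in> Units T" if x: "x \<in> carrier T" "m +>\<^bsub>T\<^esub> x \<noteq> \<zero>\<^bsub>T Quot m\<^esub>" for x
    proof (rule ccontr)
      assume "x \<notin> Units T"
      then obtain M where "maximalideal M T" "x \<in> M" by (rule T.nonunit_in_maximalideal[OF x(1)])
      then have "x \<in> m" using unique by blast
      then show False using x ker by blast
    qed
  qed (rule B, rule frac)
qed

theorem theorem2p7:
  fixes T :: "('a, 'b) ring_scheme" and m :: "'a set" and B :: "'a set set"
  defines "\<kappa> \<equiv> T Quot m"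
  defines "D \<equiv> pullback_ring T m B"
  assumes "local_domain T m"
    and "has_quotient_field B \<kappa>"
    and "m \<noteq> {\<zero>\<^bsub>T\<^esub>} \<Longrightarrow> B \<noteq> carrier \<kappa>"
  shows "(BID D \<longleftrightarrow> BID (\<kappa>\<lparr>carrier := B\<rparr>)) \<and> (SBID D \<longleftrightarrow> SBID (\<kappa>\<lparr>carrier := B\<rparr>))"
proof -
  note P = local_domain_pullback[OF assms(3) assms(4)[unfolded \<kappa>_def]]
  have "D = T\<lparr>carrier := pullback.D T ((+>\<^bsub>T\<^esub>) m) B\<rparr>"
    unfolding D_def pullback_ring_def pullback.D_def[OF P(1)] ..
  then show ?thesis
    using pullback.BID_iff_and_SBID_iff[OF P(1), unfolded P(2), OF assms(5)[unfolded \<kappa>_def]]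
    unfolding \<kappa>_def by simp
qed

end
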